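(* Let $\Omega$ be a finite set, let $f:2^{\Omega}\to\mathbb{R}$ be a monotone, non-negative and normalized submodular function, and let $A_1,\dots,A_k\subseteq\Omega$ ($k\ge 2$) be pairwise disjoint. If $A_1,\dots,A_k$ are mutually independent with respect to $f$, then they are pairwise independent with respect to $f$. However, pairwise independence does not imply mutual independence: there exist a finite set $\Omega$, a monotone, non-negative and normalized submodular function $f:2^{\Omega}\to\mathbb{R}$, an integer $k$, and pairwise disjoint sets $A_1,\dots,A_k\subseteq\Omega$ that are pairwise independent but not mutually independent with respect to $f$.
   Context: A set function $f:2^{\Omega}\to\mathbb{R}$ is submodular if $f(S)+f(T)\ge f(S\cup T)+f(S\cap T)$ for all $S,T\subseteq\Omega$; monotone if $f(S)\le f(T)$ whenever $S\subseteq T$; non-negative if $f(S)\ge 0$ for all $S$; normalized if $f(\emptyset)=0$. Sets $A_1,\dots,A_k$ are mutually independent with respect to $f$ if $f\left(\bigcup_{i=1}^k A_i\right)=\sum_{i=1}^k f(A_i)$ (equivalently, the total correlation $C_f(A_1;\dots;A_k)=\sum_{i=1}^k f(A_i)-f(\bigcup_{i=1}^k A_i)$ is zero). Sets $A_1,\dots,A_k$ are pairwise independent with respect to $f$ if for all $i\ne j$ the sets $A_i$ and $A_j$ are jointly independent, i.e. $f(A_i)+f(A_j)-f(A_i\cup A_j)=0$. *)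

theory Defs
  imports Complex_Main "HOL-Library.Disjoint_Sets"
begin

(* A set function on the power set of \<Omega> is a total HOL function on sets;
   only its values on subsets of \<Omega> are ever constrained. *)

definition submodular_on :: "'a set \<Rightarrow> ('a set \<Rightarrow> real) \<Rightarrow> bool" where
  "submodular_on \<Omega> f \<longleftrightarrow>
     (\<forall>S T. S \<subseteq> \<Omega> \<longrightarrow> T \<subseteq> \<Omega> \<longrightarrow> f S + f T \<ge> f (S \<union> T) + f (S \<inter> T))"

definition monotone_set_fun_on :: "'a set \<Rightarrow> ('a set \<Rightarrow> real) \<Rightarrow> bool" where
  "monotone_set_fun_on \<Omega> f \<longleftrightarrow> (\<forall>S T. S \<subseteq> T \<longrightarrow> T \<subseteq> \<Omega> \<longrightarrow> f S \<le> f T)"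

definition nonneg_set_fun_on :: "'a set \<Rightarrow> ('a set \<Rightarrow> real) \<Rightarrow> bool" where
  "nonneg_set_fun_on \<Omega> f \<longleftrightarrow> (\<forall>S. S \<subseteq> \<Omega> \<longrightarrow> f S \<ge> 0)"

definition normalized_set_fun :: "('a set \<Rightarrow> real) \<Rightarrow> bool" where
  "normalized_set_fun f \<longleftrightarrow> f {} = 0"

definition mutually_independent :: "('a set \<Rightarrow> real) \<Rightarrow> nat \<Rightarrow> (nat \<Rightarrow> 'a set) \<Rightarrow> bool" where
  "mutually_independent f k A \<longleftrightarrow> f (\<Union>i\<in>{1..k}. A i) = (\<Sum>i\<in>{1..k}. f (A i))"

definition pairwise_independent :: "('a set \<Rightarrow> real) \<Rightarrow> nat \<Rightarrow> (nat \<Rightarrow> 'a set) \<Rightarrow> bool" where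
  "pairwise_independent f k A \<longleftrightarrow>
     (\<forall>i\<in>{1..k}. \<forall>j\<in>{1..k}. i \<noteq> j \<longrightarrow> f (A i) + f (A j) - f (A i \<union> A j) = 0)"

end

theory Submission
  imports Defs
begin

text \<open>Non-negativity and submodularity make f subadditive, so the total correlation of a pair is at
  most that of the whole family, and both are at least 0. For the converse, the rank function of the
  uniform matroid of rank 2 on three points counts any two points independently but not all three.\<close>

lemma submodular_on_union_le:
  assumes "submodular_on \<Omega> f" "nonneg_set_fun_on \<Omega> f" "S \<subseteq> \<Omega>" "T \<subseteq> \<Omega>"
  shows "f (S \<union> T) \<le> f S + f T"
proof -
  have "f (S \<union> T) + f (S \<inter> T) \<le> f S + f T"
    using assms(1,3,4) unfolding submodular_on_def by blast
  moreover have "0 \<le> f (S \<inter> T)"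
    using assms(2,3) unfolding nonneg_set_fun_on_def by blast
  ultimately show ?thesis by linarith
qed

text \<open>Iterated two-set subadditivity: induction on \<open>I\<close> splits off one member at a
  time. Normalization settles the empty family, where the claim reads
  \<open>f {} \<le> 0\<close>.\<close>

lemma submodular_on_UN_le:
  assumes "submodular_on \<Omega> f" "nonneg_set_fun_on \<Omega> f" "normalized_set_fun f"
    and "finite I" "\<And>i. i \<in> I \<Longrightarrow> A i \<subseteq> \<Omega>"
  shows "f (\<Union>i\<in>I. A i) \<le> (\<Sum>i\<in>I. f (A i))"
  using assms(4,5)
proof (induction I rule: finite_induct)
  case empty
  then show ?case using assms(3) by (simp add: normalized_set_fun_def)
next
  case (insert x F)
  have "f (A x \<union> (\<Union>i\<in>F. A i)) \<le> f (A x) + f (\<Union>i\<in>F. A i)"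
    using submodular_on_union_le[OF assms(1,2), of "A x" "\<Union>i\<in>F. A i"] insert.prems by blast
  moreover have "f (\<Union>i\<in>F. A i) \<le> (\<Sum>i\<in>F. f (A i))"
    using insert by blast
  ultimately show ?case using insert.hyps by simp
qed

lemma mutually_independent_imp_pairwise:
  assumes sub: "submodular_on \<Omega> f" and nonneg: "nonneg_set_fun_on \<Omega> f"
    and norm: "normalized_set_fun f" and A: "\<forall>i\<in>{1..k}. A i \<subseteq> \<Omega>"
    and indep: "mutually_independent f k A"
  shows "pairwise_independent f k A"
  unfolding pairwise_independent_def
proof (intro ballI impI)
  fix i j assume ij: "i \<in> {1..k}" "j \<in> {1..k}" "i \<noteq> j"
  \<comment> \<open>Isolating \<open>i\<close> and \<open>j\<close> lets the sum and the union over
    \<open>{1..k}\<close> unfold into the chosen pair and a remainder over \<open>R\<close>.\<close>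
  define R where "R = {1..k} - {i, j}"
  have I: "{1..k} = insert i (insert j R)" and R: "finite R" "i \<notin> R" "j \<notin> R"
    using ij by (auto simp: R_def)
  have AR: "A l \<subseteq> \<Omega>" if "l \<in> R" for l
    using A that by (auto simp: R_def)
  \<comment> \<open>In the chain from here, \<open>A i \<union> A j\<close> is kept as one block and
    only the remainder is split into its members; the sums over \<open>R\<close> then
    cancel.\<close>
  have "f (A i) + f (A j) + (\<Sum>l\<in>R. f (A l)) = f ((A i \<union> A j) \<union> (\<Union>l\<in>R. A l))"
    using indep R ij(3) unfolding mutually_independent_def I by (simp add: Un_assoc)
  also have "\<dots> \<le> f (A i \<union> A j) + f (\<Union>l\<in>R. A l)"
    using submodular_on_union_le[OF sub nonneg, of "A i \<union> A j" "\<Union>l\<in>R. A l"] A ij(1,2) AR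
    by blast
  also have "\<dots> \<le> f (A i \<union> A j) + (\<Sum>l\<in>R. f (A l))"
    using submodular_on_UN_le[OF sub nonneg norm R(1) AR] by simp
  finally have "f (A i) + f (A j) \<le> f (A i \<union> A j)" by simp
  moreover have "f (A i \<union> A j) \<le> f (A i) + f (A j)"
    using submodular_on_union_le[OF sub nonneg] A ij(1,2) by blast
  ultimately show "f (A i) + f (A j) - f (A i \<union> A j) = 0" by linarith
qed

text \<open>An infinite set gets the value 0, because \<open>card\<close> does; the lemmas on
  submodularity and monotonicity therefore take \<open>\<Omega>\<close> finite.\<close>

definition uniform_rank :: "nat \<Rightarrow> 'a set \<Rightarrow> real" where
  "uniform_rank r S = real (min (card S) r)"

text \<open>Truncation at \<open>r\<close> is concave. The cardinalities of
  \<open>S \<union> T\<close> and \<open>S \<inter> T\<close> have the same sum as those of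
  \<open>S\<close> and \<open>T\<close> but lie further apart, so their truncated sum is no
  larger.\<close>

lemma submodular_on_uniform_rank:
  assumes "finite \<Omega>"
  shows "submodular_on \<Omega> (uniform_rank r)"
  unfolding submodular_on_def
proof (intro allI impI)
  fix S T assume "S \<subseteq> \<Omega>" "T \<subseteq> \<Omega>"
  then have fin: "finite S" "finite T"
    using assms finite_subset by blast+
  have "card S + card T = card (S \<union> T) + card (S \<inter> T)"
    using fin by (rule card_Un_Int)
  moreover have "card (S \<inter> T) \<le> card S" "card (S \<inter> T) \<le> card T"
    using fin by (simp_all add: card_mono)
  ultimately have "min (card (S \<union> T)) r + min (card (S \<inter> T)) r \<le> min (card S) r + min (card T) r"
    by linarith
  then show "uniform_rank r (S \<union> T) + uniform_rank r (S \<inter> T) \<le> uniform_rank r S + uniform_rank r T"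
    unfolding uniform_rank_def of_nat_add[symmetric] of_nat_le_iff .
qed

lemma monotone_uniform_rank:
  assumes "finite \<Omega>"
  shows "monotone_set_fun_on \<Omega> (uniform_rank r)"
  unfolding monotone_set_fun_on_def
proof (intro allI impI)
  fix S T assume "S \<subseteq> T" "T \<subseteq> \<Omega>"
  then have "card S \<le> card T"
    using assms by (meson card_mono finite_subset)
  then show "uniform_rank r S \<le> uniform_rank r T"
    unfolding uniform_rank_def of_nat_le_iff by (rule min.mono) simp
qed

text \<open>Two singletons have values 1 + 1 = 2, which the cap at 2 leaves intact; for all three
  the values sum to 3, while the union is capped at 2.\<close>

lemma pairwise_not_mutually_independent_uniform_rank:
  fixes A :: "nat \<Rightarrow> nat set"
  defines "A \<equiv> \<lambda>i. {i}"
  shows "pairwise_independent (uniform_rank 2) 3 A"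
    and "\<not> mutually_independent (uniform_rank 2) 3 A"
  by (auto simp: A_def pairwise_independent_def mutually_independent_def uniform_rank_def)

theorem mainTheorem6:
  shows "(\<forall>(\<Omega> :: 'a set) (f :: 'a set \<Rightarrow> real) (k :: nat) (A :: nat \<Rightarrow> 'a set).
            finite \<Omega> \<longrightarrow>
            submodular_on \<Omega> f \<longrightarrow> monotone_set_fun_on \<Omega> f \<longrightarrow>
            nonneg_set_fun_on \<Omega> f \<longrightarrow> normalized_set_fun f \<longrightarrow>
            k \<ge> 2 \<longrightarrow> (\<forall>i\<in>{1..k}. A i \<subseteq> \<Omega>) \<longrightarrow> disjoint_family_on A {1..k} \<longrightarrow>
            mutually_independent f k A \<longrightarrow> pairwise_independent f k A)
       \<and> (\<exists>(\<Omega> :: nat set) (f :: nat set \<Rightarrow> real) (k :: nat) (A :: nat \<Rightarrow> nat set).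
            finite \<Omega> \<and>
            submodular_on \<Omega> f \<and> monotone_set_fun_on \<Omega> f \<and>
            nonneg_set_fun_on \<Omega> f \<and> normalized_set_fun f \<and>
            k \<ge> 2 \<and> (\<forall>i\<in>{1..k}. A i \<subseteq> \<Omega>) \<and> disjoint_family_on A {1..k} \<and>
            pairwise_independent f k A \<and> \<not> mutually_independent f k A)"
proof (intro conjI)
  show "\<exists>(\<Omega> :: nat set) (f :: nat set \<Rightarrow> real) (k :: nat) (A :: nat \<Rightarrow> nat set).
            finite \<Omega> \<and>
            submodular_on \<Omega> f \<and> monotone_set_fun_on \<Omega> f \<and>
            nonneg_set_fun_on \<Omega> f \<and> normalized_set_fun f \<and>
            k \<ge> 2 \<and> (\<forall>i\<in>{1..k}. A i \<subseteq> \<Omega>) \<and> disjoint_family_on A {1..k} \<and>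
            pairwise_independent f k A \<and> \<not> mutually_independent f k A"
    \<comment> \<open>With ground set \<open>{1..3}\<close> each point serves as its own index.
      \<open>uniform_rank_def\<close> is first unfolded only at \<open>{}\<close>, so that the
      lemmas about \<open>uniform_rank\<close> still match; the last \<open>simp\<close> unfolds it
      fully for non-negativity.\<close>
    by (rule exI[of _ "{1..3}"], rule exI[of _ "uniform_rank 2"], rule exI[of _ 3],
        rule exI[of _ "\<lambda>i. {i}"])
      (auto simp: submodular_on_uniform_rank monotone_uniform_rank nonneg_set_fun_on_def
        normalized_set_fun_def disjoint_family_on_def uniform_rank_def[of _ "{}"]
        pairwise_not_mutually_independent_uniform_rank, simp add: uniform_rank_def)
qed (blast intro: mutually_independent_imp_pairwise)

end
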